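(* Let $n\geq 2$. Let $\bar H\subset\mathbb{RP}^n$ be a projective subspace of co-dimension $1$, and let $\bar p_1,\bar p_2,\dots,\bar p_{n+1}\in\bar H$ be generic in $\bar H$. Let $\bar p_{n+2}\in\mathbb{RP}^n\setminus\bar H$. Let $F:\mathbb{RP}^n\to\mathbb{RP}^n$ be an injective mapping that maps any projective line containing one of the points $\bar p_1,\dots,\bar p_{n+2}$ onto a projective line. Then $F$ is a projective-linear mapping.
   Context: $\mathbb{RP}^n$ is real projective $n$-space, i.e. the set of one-dimensional subspaces of $\mathbb{R}^{n+1}$. A lift of a projective point is a nonzero vector spanning it. Points in an $(n-1)$-dimensional projective space $\bar H$ (the projectivization of an $n$-dimensional linear space) are generic in $\bar H$ if, for each $k\leq n$, any $k$ of their lifts are linearly independent. $F$ maps a projective line $l$ onto a projective line if $F(l)$ is equal to a projective line. A projective-linear mapping of $\mathbb{RP}^n$ is a map induced by an invertible linear transformation of $\mathbb{R}^{n+1}$. No continuity is assumed. *)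

theory Defs
  imports "HOL-Analysis.Analysis"
begin

definition projectivization :: "'a::euclidean_space set \<Rightarrow> 'a set set" where
  "projectivization W = {L. subspace L \<and> dim L = 1 \<and> L \<subseteq> W}"

text \<open>Projective space over the whole vector space; for \<open>'a = real ^ 'd\<close> with
  \<open>CARD('d) = n + 1\<close> this is $n$-dimensional real projective space.\<close>

abbreviation RP :: "'a::euclidean_space set set" where
  "RP \<equiv> projectivization UNIV"

text \<open>The parameter \<open>d\<close> is the projective dimension, one less than the linear one.\<close>

definition proj_subspace :: "nat \<Rightarrow> 'a::euclidean_space set set \<Rightarrow> bool" where
  "proj_subspace d P \<longleftrightarrow> (\<exists>W. subspace W \<and> dim W = d + 1 \<and> P = projectivization W)"

abbreviation proj_line :: "'a::euclidean_space set set \<Rightarrow> bool" where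
  "proj_line \<equiv> proj_subspace 1"

definition is_lift :: "'a::euclidean_space \<Rightarrow> 'a set \<Rightarrow> bool" where
  "is_lift v L \<longleftrightarrow> v \<noteq> 0 \<and> span {v} = L"

text \<open>Genericity of a family of points in a \<open>d\<close>-dimensional projective space \<open>P\<close>.
  Independence is that of the indexed family \<open>v\<close>, hence the \<open>inj_on\<close>: points sharing
  a lift must not collapse into one vector of the set \<open>v ` J\<close>.\<close>

definition generic_in ::
    "nat \<Rightarrow> 'a::euclidean_space set set \<Rightarrow> ('i \<Rightarrow> 'a set) \<Rightarrow> 'i set \<Rightarrow> bool" where
  "generic_in d P p I \<longleftrightarrow>
     (\<forall>i\<in>I. p i \<in> P) \<and>
     (\<forall>k \<le> d + 1. \<forall>J \<subseteq> I. finite J \<and> card J = k \<longrightarrow>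
        (\<forall>v. (\<forall>j\<in>J. is_lift (v j) (p j)) \<longrightarrow> inj_on v J \<and> independent (v ` J)))"

definition projective_linear :: "('a::euclidean_space set \<Rightarrow> 'a set) \<Rightarrow> bool" where
  "projective_linear F \<longleftrightarrow> (\<exists>A. linear A \<and> bij A \<and> (\<forall>L\<in>RP. F L = A ` L))"

end

theory Submission
  imports Defs
begin

text \<open>
  Call a point a center of \<open>F\<close> if \<open>F\<close> maps every line through it onto a line.

  A center lets images of joins be computed: if \<open>F\<close> maps a subspace \<open>W\<close> onto a subspace \<open>W'\<close> and
  the center \<open>v\<close> lies off \<open>W\<close>, then the join of \<open>v\<close> and \<open>W\<close>, being the union of the lines from \<open>v\<close>
  to \<open>W\<close>, goes onto the join of \<open>F v\<close> and \<open>W'\<close>, and injectivity puts \<open>F v\<close> off \<open>W'\<close>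
  (\<open>image_join\<close>). Hence \<open>F\<close> preserves the independence of any family of points all but one of
  which are centers, and the span of the family goes onto the span of the images
  (\<open>image_span_centers\<close>).

  Genericity allows the lifts to be scaled so that those of the first \<open>n\<close> points form a basis
  \<open>B\<close> of the hyperplane whose sum lifts the next point; let \<open>e\<close> lift the point off the hyperplane.
  By the preservation of independence the images of these points are in the same position, so a
  linear bijection agrees with \<open>F\<close> on the \<open>n + 2\<close> points. Composing with its inverse reduces the
  theorem to the case in which \<open>F\<close> fixes all of them (\<open>projective_linear_if_frame\<close>).

  In this case \<open>F\<close> preserves the hyperplane spanned by \<open>B\<close> and acts on its complement, which is the
  affine space of the points \<open>e + x\<close>, as a map \<open>x \<mapsto> f x\<close>. The centers at infinity say that \<open>f\<close>
  preserves the direction of every line parallel to an element of \<open>B\<close> or to \<open>\<Sum>B\<close>. The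
  former make \<open>f\<close> act on each coordinate separately; the diagonal direction \<open>\<Sum>B\<close> makes all these
  coordinate maps equal and additive, since there are at least two of them. The center \<open>e\<close>
  says that \<open>f\<close> preserves lines through the origin, and this makes the common coordinate map
  multiplicative up to a constant factor. An additive and multiplicative function on the reals that
  maps 1 to 1 is the identity because it is monotone, so \<open>f\<close> is a homothety (\<open>chart_scaling\<close>).
  Finally each point of the hyperplane is fixed, as the line joining it
  to \<open>e\<close> is preserved.
\<close>

section \<open>Points and lines through lifts\<close>

lemma projectivization_iff:
  assumes "subspace W"
  shows "L \<in> projectivization W \<longleftrightarrow> (\<exists>v\<in>W. v \<noteq> 0 \<and> L = span {v})"
proof
  assume L: "L \<in> projectivization W"
  then have sub: "subspace L" "dim L = 1" "L \<subseteq> W" by (auto simp: projectivization_def)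
  obtain B where B: "B \<subseteq> L" "independent B" "L \<subseteq> span B" "card B = dim L"
    using basis_exists by blast
  with sub obtain v where v: "B = {v}" by (metis card_1_singletonE)
  with B have "v \<noteq> 0" by (metis dependent_zero insertI1)
  moreover have "L = span {v}"
    using B sub v by (metis span_subspace)
  ultimately show "\<exists>v\<in>W. v \<noteq> 0 \<and> L = span {v}" using B v sub by blast
next
  assume "\<exists>v\<in>W. v \<noteq> 0 \<and> L = span {v}"
  then obtain v where "v \<in> W" "v \<noteq> 0" "L = span {v}" by blast
  then show "L \<in> projectivization W"
    using assms by (simp add: projectivization_def dim_eq_card_independent span_minimal)
qed

lemma span_in_projectivization [simp]:
  assumes "subspace W" "v \<noteq> 0"
  shows "span {v} \<in> projectivization W \<longleftrightarrow> v \<in> W"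
proof
  assume "span {v} \<in> projectivization W"
  then show "v \<in> W" by (auto simp: projectivization_def intro: span_base)
qed (use assms projectivization_iff in blast)

lemma span_in_RP [simp]: "v \<noteq> 0 \<Longrightarrow> span {v} \<in> RP"
  by simp

lemma RP_lift:
  assumes "L \<in> RP"
  obtains v where "v \<noteq> 0" "L = span {v}"
  using assms projectivization_iff[of UNIV] by auto

lemma span_singleton_eq:
  assumes "u \<noteq> (0::'a::euclidean_space)" "u \<in> span {v}"
  shows "span {u} = span {v}"
proof -
  obtain c where c: "u = c *\<^sub>R v" using assms by (auto simp: span_singleton)
  with assms have "v = (1/c) *\<^sub>R u" by auto
  then have "v \<in> span {u}" by (metis span_base span_mul singletonI)
  with assms show ?thesis by (simp add: span_eq)
qed

lemma independent_pair_iff: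
  "independent {u, v} \<and> u \<noteq> v \<longleftrightarrow> v \<noteq> 0 \<and> u \<notin> span {v::'a::euclidean_space}"
  by (auto simp: independent_insert span_base)

lemma proj_line_span:
  assumes "v \<noteq> 0" "u \<notin> span {v::'a::euclidean_space}"
  shows "proj_line (projectivization (span {u, v}))"
proof -
  have "independent {u, v}" "u \<noteq> v" using assms independent_pair_iff by blast+
  then have "dim (span {u, v}) = 2" by (simp add: dim_eq_card_independent)
  then show ?thesis unfolding proj_subspace_def by (intro exI[of _ "span {u, v}"]) simp
qed

lemma proj_line_through:
  assumes l: "proj_line l" "span {u} \<in> l" "span {v} \<in> l"
    and uv: "v \<noteq> 0" "u \<notin> span {v::'a::euclidean_space}"
  shows "l = projectivization (span {u, v})"
proof -
  obtain W where W: "subspace W" "dim W = 2" "l = projectivization W"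
    using l by (auto simp: proj_subspace_def)
  have "u \<noteq> 0" using uv span_zero by blast
  then have mem: "u \<in> W" "v \<in> W" using W l uv by simp_all
  have "independent {u, v}" "u \<noteq> v" using uv independent_pair_iff by blast+
  then have "dim (span {u, v}) = dim W" using W by (simp add: dim_eq_card_independent)
  then have "span {u, v} = W"
    using mem W span_minimal[of "{u, v}" W] by (intro subspace_dim_equal) auto
  with W show ?thesis by simp
qed

lemma image_projectivization:
  assumes "linear A" "inj A"
  shows "(`) A ` projectivization W = projectivization (A ` W)"
proof (intro set_eqI iffI)
  fix L assume "L \<in> (`) A ` projectivization W"
  then show "L \<in> projectivization (A ` W)"
    using assms dim_image_eq[of A]
    by (auto simp: projectivization_def linear_subspace_image dim_image_eq inj_on_def)
next
  fix L assume L: "L \<in> projectivization (A ` W)"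
  then have "L \<subseteq> A ` W" by (simp add: projectivization_def)
  then obtain M where M: "M \<subseteq> W" "L = A ` M" by (auto simp: subset_image_iff)
  then have "M = A -` L" using assms by (simp add: inj_vimage_image_eq)
  then have "subspace M"
    using L assms by (simp add: projectivization_def linear_subspace_vimage)
  moreover have "dim M = 1"
    using L M assms by (simp add: projectivization_def dim_image_eq inj_on_def)
  ultimately show "L \<in> (`) A ` projectivization W"
    using M by (auto simp: projectivization_def)
qed

lemma proj_line_image:
  assumes "linear A" "inj A" "proj_line l"
  shows "proj_line ((`) A ` l)"
proof -
  obtain W where W: "subspace W" "dim W = 2" "l = projectivization W"
    using assms by (auto simp: proj_subspace_def)
  then have "subspace (A ` W)" "dim (A ` W) = 2"
    using assms by (simp_all add: linear_subspace_image dim_image_eq inj_on_def)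
  then show ?thesis
    unfolding proj_subspace_def using W assms
    by (intro exI[of _ "A ` W"]) (simp add: image_projectivization)
qed

lemma linear_bij_on_basis:
  fixes g :: "'a \<Rightarrow> 'a::euclidean_space"
  assumes "independent S" "span (g ` S) = UNIV"
  obtains A where "linear A" "bij A" "\<And>x. x \<in> S \<Longrightarrow> A x = g x"
proof -
  obtain A where A: "linear A" "\<forall>x\<in>S. A x = g x"
    using linear_independent_extend[OF assms(1)] by blast
  have "span (g ` S) = A ` span S"
    using A linear_span_image[of A S] by (metis image_cong)
  then have "surj A" using assms by auto
  with A(1) have "inj A" by (simp add: linear_surjective_imp_injective)
  with \<open>surj A\<close> A that show ?thesis by (simp add: bij_def)
qed

text \<open>This turns genericity, a condition on the independence of subfamilies, into coordinates: if some
  coefficient vanished, \<open>s\<close> would lie in the span of the remaining vectors.\<close>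

lemma nonzero_coefficients:
  assumes "finite B" "s \<in> span B"
    and "\<And>b. b \<in> B \<Longrightarrow> s \<notin> span (B - {b})"
  obtains c where "\<And>b. b \<in> B \<Longrightarrow> c b \<noteq> 0" "s = (\<Sum>b\<in>B. c b *\<^sub>R b)"
proof -
  obtain c where c: "s = (\<Sum>b\<in>B. c b *\<^sub>R b)"
    using assms span_finite[OF assms(1)] by auto
  have "c b \<noteq> 0" if "b \<in> B" for b
  proof
    assume "c b = 0"
    then have "s = (\<Sum>b\<in>B - {b}. c b *\<^sub>R b)"
      using that assms(1) c by (simp add: sum.remove)
    also have "\<dots> \<in> span (B - {b})"
      by (intro span_sum span_mul span_base)
    finally show False using assms that by blast
  qed
  with c that show ?thesis by blast
qed

section \<open>Additive and multiplicative real functions\<close>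

text \<open>Multiplicativity makes \<open>a\<close> nonnegative on squares, so by additivity it is monotone; being the identity
  on the dense set of rationals, it is the identity.\<close>

lemma multiplicative_additive_real:
  fixes a :: "real \<Rightarrow> real"
  assumes add: "\<And>x y. a (x + y) = a x + a y"
    and mult: "\<And>x y. a (x * y) = a x * a y"
    and one: "a 1 = 1"
  shows "a x = x"
proof -
  interpret additive a by unfold_locales (fact add)
  have mono: "a x \<le> a y" if "x \<le> y" for x y
  proof -
    have "a (y - x) = a (sqrt (y - x)) * a (sqrt (y - x))"
      using that by (simp flip: mult)
    then show ?thesis by (metis diff diff_ge_0_iff_ge zero_le_square)
  qed
  have nat: "a (of_nat k) = of_nat k" for k
    by (induction k) (simp_all add: zero add one)
  have int: "a (of_int k) = of_int k" for k
    by (cases k rule: int_diff_cases) (simp add: diff nat)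
  have rat: "a q = q" if "q \<in> \<rat>" for q
  proof -
    obtain m n where q: "q = of_int m / of_int n" "n \<noteq> 0"
      using \<open>q \<in> \<rat>\<close> by (metis Rats_cases' less_irrefl)
    have "a q * of_int n = a (q * of_int n)" by (simp only: mult int)
    also have "\<dots> = of_int m" using q by (simp add: int)
    finally have "a q * of_int n = of_int m" .
    with q show ?thesis by (metis nonzero_eq_divide_eq of_int_0_eq_iff)
  qed
  show ?thesis
  proof (rule ccontr)
    assume "a x \<noteq> x"
    then consider "a x < x" | "x < a x" by linarith
    then show False
    proof cases
      case 1
      then obtain q where "q \<in> \<rat>" "a x < q" "q < x" using Rats_dense_in_real by blast
      then show False using mono[of q x] rat by simp
    next
      case 2
      then obtain q where "q \<in> \<rat>" "x < q" "q < a x" using Rats_dense_in_real by blast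
      then show False using mono[of x q] rat by simp
    qed
  qed
qed

section \<open>Injective maps with centers\<close>

definition is_center :: "('a::euclidean_space set \<Rightarrow> 'a set) \<Rightarrow> 'a \<Rightarrow> bool" where
  "is_center F v \<longleftrightarrow> v \<noteq> 0 \<and> (\<forall>l. proj_line l \<and> span {v} \<in> l \<longrightarrow> proj_line (F ` l))"

locale projective_injection =
  fixes F :: "'a::euclidean_space set \<Rightarrow> 'a set"
  assumes maps_RP: "L \<in> RP \<Longrightarrow> F L \<in> RP"
    and inj_RP: "inj_on F RP"
begin

definition image_lift :: "'a \<Rightarrow> 'a" where
  "image_lift v = (SOME w. w \<noteq> 0 \<and> F (span {v}) = span {w})"

lemma image_lift:
  assumes "v \<noteq> 0"
  shows "image_lift v \<noteq> 0" "F (span {v}) = span {image_lift v}"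
proof -
  have "\<exists>w. w \<noteq> 0 \<and> F (span {v}) = span {w}"
    using maps_RP[OF span_in_RP[OF assms]] by (metis RP_lift)
  then show "image_lift v \<noteq> 0" "F (span {v}) = span {image_lift v}"
    unfolding image_lift_def by (metis (mono_tags, lifting) someI_ex)+
qed

text \<open>Every point of \<open>W'\<close> already has a preimage in \<open>W\<close>, so by injectivity it cannot be the image of a point off \<open>W\<close>.\<close>

lemma image_notin:
  assumes W: "subspace W" "subspace W'" "projectivization W' \<subseteq> F ` projectivization W"
    and v: "v \<noteq> 0" "v \<notin> W" and w: "F (span {v}) = span {w}" "w \<noteq> 0"
  shows "w \<notin> W'"
proof
  assume "w \<in> W'"
  then have "F (span {v}) \<in> projectivization W'" using W w by simp
  then obtain L where L: "L \<in> projectivization W" "F (span {v}) = F L" using W by blast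
  then have "L \<in> RP" by (auto simp: projectivization_def)
  with L have "span {v} = L" using inj_RP v by (meson inj_onD span_in_RP)
  with L(1) have "span {v} \<in> projectivization W" by simp
  with v W show False by simp
qed

lemma image_line:
  assumes "is_center F v" "u \<notin> span {v}"
    and v': "F (span {v}) = span {v'}" "v' \<noteq> 0" and u': "F (span {u}) = span {u'}" "u' \<noteq> 0"
  shows "u' \<notin> span {v'}" "F ` projectivization (span {u, v}) = projectivization (span {u', v'})"
proof -
  have nz: "v \<noteq> 0" "u \<noteq> 0" using assms span_zero by (auto simp: is_center_def)
  show notin: "u' \<notin> span {v'}"
  proof
    assume "u' \<in> span {v'}"
    then have "F (span {u}) = F (span {v})" using v' u' span_singleton_eq by metis
    then have "span {u} = span {v}" using inj_RP nz by (meson inj_onD span_in_RP)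
    then show False using assms(2) span_base by blast
  qed
  have mem: "span {u} \<in> projectivization (span {u, v})" "span {v} \<in> projectivization (span {u, v})"
    using nz by (simp_all add: span_base)
  have "proj_line (F ` projectivization (span {u, v}))"
    using assms(1) proj_line_span[OF nz(1) assms(2)] mem by (auto simp: is_center_def)
  moreover have "span {u'} \<in> F ` projectivization (span {u, v})"
      "span {v'} \<in> F ` projectivization (span {u, v})"
    using mem v' u' by (metis imageI)+
  ultimately show "F ` projectivization (span {u, v}) = projectivization (span {u', v'})"
    using proj_line_through v' notin by blast
qed

text \<open>The join of \<open>v\<close> and \<open>W\<close> is the union of the lines that join \<open>v\<close> to points of \<open>W\<close>, and \<open>F\<close> maps
  each of them onto the line that joins \<open>w\<close> to a point of \<open>W'\<close>; every point of \<open>W'\<close> occurs.\<close>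

lemma image_join:
  assumes v: "is_center F v" and W: "subspace W" "subspace W'" "v \<notin> W"
    and img: "F ` projectivization W = projectivization W'"
    and w: "F (span {v}) = span {w}" "w \<noteq> 0"
  shows "F ` projectivization (span (insert v W)) = projectivization (span (insert w W'))"
proof (intro set_eqI iffI)
  fix L assume "L \<in> F ` projectivization (span (insert v W))"
  then obtain u where u: "u \<in> span (insert v W)" "u \<noteq> 0" "L = F (span {u})"
    by (auto simp: projectivization_iff)
  then obtain k where k: "u - k *\<^sub>R v \<in> W" using W span_breakdown_eq[of u v W]
    by (auto simp: span_eq_iff[THEN iffD2])
  \<comment> \<open>The line from \<open>v\<close> to \<open>u\<close> meets \<open>W\<close> in \<open>x\<close>, unless \<open>u\<close> and \<open>v\<close> are the same point.\<close>
  define x where "x = u - k *\<^sub>R v"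
  show "L \<in> projectivization (span (insert w W'))"
  proof (cases "x = 0")
    case True
    then have "span {u} = span {v}"
      using u by (intro span_singleton_eq) (auto simp: x_def span_base span_mul)
    then show ?thesis using u w by (simp add: span_base)
  next
    case False
    have xW: "x \<in> W" using k x_def by simp
    then have "x \<notin> span {v}"
      using False W span_singleton_eq[of x v] span_minimal[of "{x}" W] span_base[of v "{v}"] by auto
    note line = image_line[OF v this w image_lift(2)[OF False] image_lift(1)[OF False]]
    have "span {image_lift x} \<in> projectivization W'"
      using xW False W img image_lift(2)[OF False] by (metis imageI span_in_projectivization)
    then have "image_lift x \<in> W'" using W image_lift(1)[OF False] by simp
    then have "span {image_lift x, w} \<subseteq> span (insert w W')" by (intro span_mono) auto
    moreover have "u = x + k *\<^sub>R v" by (simp add: x_def)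
    then have "u \<in> span {x, v}" by (simp add: span_add span_base span_mul)
    then have "L \<in> projectivization (span {image_lift x, w})"
      using u line(2) by (metis imageI span_in_projectivization subspace_span)
    ultimately show ?thesis by (auto simp: projectivization_def)
  qed
next
  have nz: "v \<noteq> 0" using v by (simp add: is_center_def)
  fix L assume "L \<in> projectivization (span (insert w W'))"
  then obtain u where u: "u \<in> span (insert w W')" "u \<noteq> 0" "L = span {u}"
    by (auto simp: projectivization_iff)
  then obtain k where k: "u - k *\<^sub>R w \<in> W'" using W span_breakdown_eq[of u w W']
    by (auto simp: span_eq_iff[THEN iffD2])
  define y where "y = u - k *\<^sub>R w"
  show "L \<in> F ` projectivization (span (insert v W))"
  proof (cases "y = 0")
    case True
    then have "span {u} = span {w}"
      using u by (intro span_singleton_eq) (auto simp: y_def span_base span_mul)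
    then have "L = F (span {v})" using u w by simp
    then show ?thesis using nz by (simp add: span_base)
  next
    case False
    then have "span {y} \<in> F ` projectivization W" using k W img y_def by simp
    then obtain x where x: "x \<in> W" "x \<noteq> 0" "F (span {x}) = span {y}"
      using projectivization_iff[OF W(1)] by (metis imageE)
    then have "x \<notin> span {v}"
      using W span_singleton_eq[of x v] span_minimal[of "{x}" W] span_base[of v "{v}"] by auto
    note line = image_line[OF v this w x(3) False]
    have "u = y + k *\<^sub>R w" by (simp add: y_def)
    then have "u \<in> span {y, w}" by (simp add: span_add span_base span_mul)
    then have "L \<in> F ` projectivization (span {x, v})" using line(2) u by simp
    moreover have "span {x, v} \<subseteq> span (insert v W)" using x by (intro span_mono) auto
    ultimately show ?thesis by (auto simp: projectivization_def)
  qed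
qed

text \<open>The join with one center at a time, starting from the point \<open>x\<close>; each new
  image lies off the span of the earlier ones.\<close>

lemma image_span_centers:
  assumes "finite S" "\<And>v. v \<in> S \<Longrightarrow> is_center F v" "x \<notin> S" "independent (insert x S)"
  shows "F ` projectivization (span (insert x S))
           = projectivization (span (image_lift ` insert x S))
       \<and> independent (image_lift ` insert x S) \<and> inj_on image_lift (insert x S)"
  using assms
proof (induction S)
  case empty
  then have x: "x \<noteq> 0" by simp
  have "projectivization (span {y}) = {span {y}}" if "y \<noteq> 0" for y :: 'a
  proof (intro equalityI subsetI)
    fix L assume "L \<in> projectivization (span {y})"
    then show "L \<in> {span {y}}"
      using span_singleton_eq[of _ y] by (auto simp only: projectivization_iff[OF subspace_span])
  qed (use that in \<open>simp add: span_base\<close>)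
  then show ?case using image_lift[OF x] x by simp
next
  case (insert v S)
  have "independent (insert v (insert x S))" using insert.prems by (simp add: insert_commute)
  moreover have vn: "v \<notin> insert x S" using insert by auto
  ultimately have ind: "independent (insert x S)" "v \<notin> span (insert x S)"
    by (auto simp: independent_insert)
  have c: "is_center F v" and nz: "v \<noteq> 0" using insert.prems by (auto simp: is_center_def)
  have IH: "F ` projectivization (span (insert x S))
           = projectivization (span (image_lift ` insert x S))"
       "independent (image_lift ` insert x S)" "inj_on image_lift (insert x S)"
    using insert ind by auto
  have notin: "image_lift v \<notin> span (image_lift ` insert x S)"
    using image_notin[of "span (insert x S)" "span (image_lift ` insert x S)" v "image_lift v"]
      IH ind nz image_lift[OF nz] by simp
  have "F ` projectivization (span (insert v (span (insert x S))))
      = projectivization (span (insert (image_lift v) (span (image_lift ` insert x S))))"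
    using image_join[OF c _ _ ind(2) IH(1)] image_lift[OF nz] by simp
  moreover have "span (insert y (span T)) = span (insert y T)" for y and T :: "'a set"
  proof (rule antisym)
    show "span (insert y (span T)) \<subseteq> span (insert y T)"
      using span_mono[of T "insert y T"] by (intro span_minimal) (auto intro: span_base)
    show "span (insert y T) \<subseteq> span (insert y (span T))"
      by (intro span_mono) (auto intro: span_base)
  qed
  ultimately have "F ` projectivization (span (insert v (insert x S)))
           = projectivization (span (insert (image_lift v) (image_lift ` insert x S)))"
    by simp
  moreover have "independent (insert (image_lift v) (image_lift ` insert x S))"
    using notin IH(2) by (rule independent_insertI)
  moreover have "image_lift v \<notin> image_lift ` insert x S"
    using notin span_base by metis
  then have "inj_on image_lift (insert v (insert x S))"
    unfolding inj_on_insert[of image_lift v] using IH(3) by blast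
  moreover have "insert x (insert v S) = insert v (insert x S)" by blast
  ultimately show ?case by (simp only: image_insert simp_thms)
qed

end

section \<open>Maps fixing a projective frame of centers\<close>

lemma in_span_pair: "x \<in> span {u, v} \<longleftrightarrow> (\<exists>a b. x = a *\<^sub>R u + b *\<^sub>R v)"
  for x :: "'a::euclidean_space"
proof -
  have "x = a *\<^sub>R u + b *\<^sub>R v \<longleftrightarrow> x - a *\<^sub>R u = b *\<^sub>R v" for a b
    by (auto simp: algebra_simps)
  then show ?thesis by (auto simp: span_breakdown_eq[of x u] span_singleton)
qed

locale fixed_frame = projective_injection F for F :: "'a::euclidean_space set \<Rightarrow> 'a set" +
  fixes B :: "'a set" and e :: 'a
  assumes independent_B: "independent B"
    and two_le_card: "2 \<le> card B"
    and center_B: "b \<in> B \<Longrightarrow> is_center F b"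
    and center_sum: "is_center F (\<Sum>B)"
    and center_e: "is_center F e"
    and e_notin: "e \<notin> span B"
    and span_UNIV: "span (insert e B) = UNIV"
    and fixed_B: "b \<in> B \<Longrightarrow> F (span {b}) = span {b}"
    and fixed_sum: "F (span {\<Sum>B}) = span {\<Sum>B}"
    and fixed_e: "F (span {e}) = span {e}"
begin

lemma finite_B: "finite B"
  using independent_B by (rule independent_imp_finite)

lemma e_coefficient_zero: "k *\<^sub>R e \<in> span B \<Longrightarrow> k = 0"
  using e_notin span_mul[of "k *\<^sub>R e" B "1 / k"] by (cases "k = 0") auto

lemma chart_nonzero: "x \<in> span B \<Longrightarrow> e + x \<noteq> 0"
  using e_notin span_neg[of x B] by (metis add_eq_0_iff2)

lemma chart_notin: "x \<in> span B \<Longrightarrow> e + x \<notin> span B"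
  using e_notin span_diff[of "e + x" B x] by auto

text \<open>This makes the hyperplane spanned by \<open>B\<close> a hyperplane at infinity: \<open>F\<close> also preserves its
  complement, where it can be studied as an affine map.\<close>

lemma image_hyperplane: "F ` projectivization (span B) = projectivization (span B)"
proof -
  obtain b where b: "b \<in> B" using two_le_card by fastforce
  have lift: "span {image_lift v} = span {v}" if "v \<in> B" for v
    using that center_B fixed_B image_lift(2)[of v] by (simp add: is_center_def)
  then have "image_lift ` B \<subseteq> span B"
    using span_base[of "image_lift _" "{image_lift _}"] span_mono[of "{_}" B] by blast
  moreover have "B \<subseteq> span (image_lift ` B)"
    using lift span_base[of _ "{_}"] span_mono[of "{image_lift _}" "image_lift ` B"] by blast
  ultimately have "span (image_lift ` B) = span B" by (simp add: span_eq)
  moreover have "insert b (B - {b}) = B" using b by blast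
  ultimately show ?thesis
    using image_span_centers[of "B - {b}" b] finite_B independent_B center_B by simp
qed

text \<open>The point spanned by \<open>e + x\<close> has affine coordinate \<open>x\<close>; in these coordinates \<open>F\<close> is \<open>chart\<close>.\<close>
definition chart :: "'a \<Rightarrow> 'a" where
  "chart x = (SOME h. h \<in> span B \<and> F (span {e + x}) = span {e + h})"

lemma chart:
  assumes x: "x \<in> span B"
  shows "chart x \<in> span B" "F (span {e + x}) = span {e + chart x}"
proof -
  define w where "w = image_lift (e + x)"
  have w: "w \<noteq> 0" "F (span {e + x}) = span {w}"
    using image_lift[OF chart_nonzero[OF x]] by (simp_all add: w_def)
  have notin: "w \<notin> span B"
    using image_notin[of "span B" "span B" "e + x" w] image_hyperplane chart_nonzero[OF x]
      chart_notin[OF x] w by simp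
  have "w \<in> span (insert e B)" using span_UNIV by simp
  then obtain k where k: "w - k *\<^sub>R e \<in> span B" using span_breakdown_eq[of w e B] by blast
  with notin have "k \<noteq> 0" by (cases "k = 0") auto
  then have "e + (1 / k) *\<^sub>R (w - k *\<^sub>R e) = (1 / k) *\<^sub>R w" by (simp add: algebra_simps)
  then have "e + (1 / k) *\<^sub>R (w - k *\<^sub>R e) \<in> span {w}"
    by (simp add: span_base span_mul)
  moreover have h: "(1 / k) *\<^sub>R (w - k *\<^sub>R e) \<in> span B" using k by (rule span_mul)
  ultimately have "F (span {e + x}) = span {e + (1 / k) *\<^sub>R (w - k *\<^sub>R e)}"
    using span_singleton_eq[OF chart_nonzero] w by metis
  with h have "\<exists>h. h \<in> span B \<and> F (span {e + x}) = span {e + h}" by blast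
  then show "chart x \<in> span B" "F (span {e + x}) = span {e + chart x}"
    unfolding chart_def by (metis (mono_tags, lifting) someI_ex)+
qed

lemma chart_zero: "chart 0 = 0"
proof -
  have "span {e + chart 0} = span {e}" using chart(2)[of 0] fixed_e by (simp add: span_zero)
  then obtain k where k: "e + chart 0 = k *\<^sub>R e"
    using span_base[of "e + chart 0" "{e + chart 0}"] by (auto simp: span_singleton)
  then have "(k - 1) *\<^sub>R e = chart 0" by (simp add: algebra_simps)
  then have "k - 1 = 0" using chart(1)[of 0] e_coefficient_zero[of "k - 1"] by (simp add: span_zero)
  with k show ?thesis by simp
qed

lemma chart_inj:
  assumes "x \<in> span B" "chart x = 0"
  shows "x = 0"
proof -
  have "F (span {e + x}) = F (span {e})" using chart(2)[OF assms(1)] assms(2) fixed_e by simp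
  moreover have "e \<noteq> 0" using center_e by (simp add: is_center_def)
  ultimately have "span {e + x} = span {e}"
    using inj_RP chart_nonzero[OF assms(1)] by (meson inj_onD span_in_RP)
  then obtain k where k: "e + x = k *\<^sub>R e"
    using span_base[of "e + x" "{e + x}"] by (auto simp: span_singleton)
  then have "(k - 1) *\<^sub>R e = x" by (simp add: algebra_simps)
  then have "k - 1 = 0" using assms e_coefficient_zero[of "k - 1"] by simp
  with k show ?thesis by simp
qed

text \<open>The point at infinity \<open>d\<close> is fixed, so the affine line through \<open>x\<close> in the direction \<open>d\<close>
  goes to the line through \<open>chart x\<close> in the same direction.\<close>

lemma chart_parallel:
  assumes d: "is_center F d" "d \<in> span B" "F (span {d}) = span {d}" and x: "x \<in> span B"
  obtains m where "chart (x + t *\<^sub>R d) = chart x + m *\<^sub>R d"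
proof -
  have nz: "d \<noteq> 0" using d by (simp add: is_center_def)
  have y: "x + t *\<^sub>R d \<in> span B" using d x by (intro span_add span_mul)
  have "e + x \<notin> span {d}" using chart_notin[OF x] d(2) span_minimal[of "{d}" "span B"] by auto
  note line = image_line(2)[OF d(1) this d(3) nz chart(2)[OF x] chart_nonzero[OF chart(1)[OF x]]]
  have "e + (x + t *\<^sub>R d) = 1 *\<^sub>R (e + x) + t *\<^sub>R d" by simp
  then have "e + (x + t *\<^sub>R d) \<in> span {e + x, d}" using in_span_pair by blast
  then have "span {e + chart (x + t *\<^sub>R d)} \<in> projectivization (span {e + chart x, d})"
    using line chart(2)[OF y] chart_nonzero[OF y]
    by (metis imageI span_in_projectivization subspace_span)
  then obtain k m where km: "e + chart (x + t *\<^sub>R d) = k *\<^sub>R (e + chart x) + m *\<^sub>R d"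
    using chart_nonzero[OF chart(1)[OF y]] by (auto simp: in_span_pair)
  then have "(1 - k) *\<^sub>R e = k *\<^sub>R chart x + m *\<^sub>R d - chart (x + t *\<^sub>R d)"
    by (simp add: algebra_simps)
  also have "\<dots> \<in> span B"
    using chart(1)[OF x] chart(1)[OF y] d(2) by (intro span_add span_diff span_mul)
  finally have "k = 1" using e_coefficient_zero[of "1 - k"] by simp
  with km have "chart (x + t *\<^sub>R d) = chart x + m *\<^sub>R d" by simp
  then show ?thesis by (rule that)
qed

text \<open>The line joining \<open>e\<close> to \<open>e + x\<close> consists of the points \<open>e + t *\<^sub>R x\<close> and one point at
  infinity; its image joins \<open>e\<close> to \<open>e + chart x\<close>.\<close>

lemma chart_homothety:
  assumes x: "x \<in> span B"
  obtains m where "chart (t *\<^sub>R x) = m *\<^sub>R chart x"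
proof (cases "x = 0")
  case True
  with that[of 1] show ?thesis by simp
next
  case False
  have nz: "e \<noteq> 0" using center_e by (simp add: is_center_def)
  have y: "t *\<^sub>R x \<in> span B" using x by (rule span_mul)
  have "e + x \<notin> span {e}"
  proof
    assume "e + x \<in> span {e}"
    then obtain k where k: "e + x = k *\<^sub>R e" by (auto simp: span_singleton)
    then have "(k - 1) *\<^sub>R e = x" by (simp add: algebra_simps)
    then have "k - 1 = 0" using x e_coefficient_zero[of "k - 1"] by simp
    with k False show False by simp
  qed
  note line = image_line(2)[OF center_e this fixed_e nz chart(2)[OF x] chart_nonzero[OF chart(1)[OF x]]]
  have "e + t *\<^sub>R x = t *\<^sub>R (e + x) + (1 - t) *\<^sub>R e" by (simp add: algebra_simps)
  then have "e + t *\<^sub>R x \<in> span {e + x, e}" using in_span_pair by blast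
  then have "span {e + chart (t *\<^sub>R x)} \<in> projectivization (span {e + chart x, e})"
    using line chart(2)[OF y] chart_nonzero[OF y]
    by (metis imageI span_in_projectivization subspace_span)
  then obtain k m where km: "e + chart (t *\<^sub>R x) = k *\<^sub>R (e + chart x) + m *\<^sub>R e"
    using chart_nonzero[OF chart(1)[OF y]] by (auto simp: in_span_pair)
  then have "(1 - k - m) *\<^sub>R e = k *\<^sub>R chart x - chart (t *\<^sub>R x)"
    by (simp add: algebra_simps)
  moreover have "\<dots> \<in> span B"
    using chart(1)[OF x] chart(1)[OF y] by (intro span_diff span_mul)
  ultimately have "1 - k - m = 0" using e_coefficient_zero[of "1 - k - m"] by simp
  with \<open>(1 - k - m) *\<^sub>R e = k *\<^sub>R chart x - chart (t *\<^sub>R x)\<close> that[of k] show ?thesis by simp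
qed

abbreviation coord :: "'a \<Rightarrow> 'a \<Rightarrow> real" where
  "coord b x \<equiv> representation B x b"

lemmas coord_add = representation_add[OF independent_B]
  and coord_scale = representation_scale[OF independent_B]

lemma coord_basis: "c \<in> B \<Longrightarrow> coord b c = (if b = c then 1 else 0)"
  by (simp add: representation_basis[OF independent_B])

lemma coord_sum: "b \<in> B \<Longrightarrow> coord b (\<Sum>B) = 1"
  using representation_sum[OF independent_B, of B "\<lambda>x. x"] finite_B
  by (simp add: span_base coord_basis)

lemma coord_expansion: "x \<in> span B \<Longrightarrow> (\<Sum>b\<in>B. coord b x *\<^sub>R b) = x"
  using sum_representation_eq[OF independent_B, of x B] finite_B by simp

definition coord_map :: "'a \<Rightarrow> real \<Rightarrow> real" where
  "coord_map b t = coord b (chart (t *\<^sub>R b))"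

text \<open>A move in a basis direction \<open>c\<close> other than \<open>b\<close> changes the image by a multiple of \<open>c\<close>,
  leaving its coordinate at \<open>b\<close> as it was. Hence all the other coordinates of \<open>x\<close> may be set to
  zero.\<close>

lemma coord_chart:
  assumes b: "b \<in> B" and x: "x \<in> span B"
  shows "coord b (chart x) = coord_map b (coord b x)"
proof -
  have shift: "coord b (chart (y + (\<Sum>c\<in>S. u c *\<^sub>R c))) = coord b (chart y)"
    if "finite S" "S \<subseteq> B - {b}" "y \<in> span B" for S u y
    using that
  proof (induction S arbitrary: y)
    case (insert c S)
    then have c: "c \<in> B" "c \<noteq> b" by auto
    define z where "z = y + (\<Sum>c\<in>S. u c *\<^sub>R c)"
    have z: "z \<in> span B"
      unfolding z_def using insert.prems
      by (intro span_add[OF insert.prems(2)] span_sum span_mul span_base) auto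
    obtain m where m: "chart (z + u c *\<^sub>R c) = chart z + m *\<^sub>R c"
      using chart_parallel[OF center_B[OF c(1)] span_base[OF c(1)] fixed_B[OF c(1)] z] .
    then have "coord b (chart (z + u c *\<^sub>R c)) = coord b (chart z)"
      using c chart(1)[OF z] by (simp add: coord_add coord_scale coord_basis span_base span_mul)
    then show ?case using insert by (simp add: z_def algebra_simps)
  qed simp
  have "x = coord b x *\<^sub>R b + (\<Sum>c\<in>B - {b}. coord c x *\<^sub>R c)"
    using coord_expansion[OF x] finite_B b by (simp add: sum.remove)
  then show ?thesis
    using shift[of "B - {b}" "coord b x *\<^sub>R b" "\<lambda>c. coord c x"] finite_B b
    by (simp add: coord_map_def span_base span_mul)
qed

lemma coord_map_zero: "coord_map b 0 = 0"
  by (simp add: coord_map_def chart_zero representation_zero)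

text \<open>A move along \<open>\<Sum>B\<close> shifts all coordinates by the same amount, and so does the resulting move
  of the image.\<close>

lemma coord_map_diagonal:
  assumes b: "b \<in> B" "c \<in> B" and x: "x \<in> span B"
  shows "coord_map b (coord b x + t) - coord_map b (coord b x)
       = coord_map c (coord c x + t) - coord_map c (coord c x)"
proof -
  have s: "\<Sum>B \<in> span B" by (intro span_sum span_base)
  have y: "x + t *\<^sub>R \<Sum>B \<in> span B" using s x by (intro span_add span_mul)
  obtain m where m: "chart (x + t *\<^sub>R \<Sum>B) = chart x + m *\<^sub>R \<Sum>B"
    using chart_parallel[OF center_sum s fixed_sum x] .
  have "coord_map d (coord d x + t) - coord_map d (coord d x) = m" if d: "d \<in> B" for d
  proof -
    have "coord d (x + t *\<^sub>R \<Sum>B) = coord d x + t"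
      using x s d by (simp add: coord_add coord_scale coord_sum span_mul)
    then have "coord_map d (coord d x + t) = coord d (chart x + m *\<^sub>R \<Sum>B)"
      using coord_chart[OF d y] m by simp
    also have "\<dots> = coord_map d (coord d x) + m"
      using chart(1)[OF x] s d coord_chart[OF d x]
      by (simp add: coord_add coord_scale coord_sum span_mul)
    finally show ?thesis by simp
  qed
  with b show ?thesis by simp
qed

text \<open>The equations for the diagonal direction give one additive map \<open>a\<close> on all coordinates. A vector with
  coordinates \<open>1\<close> and \<open>u\<close>, scaled by \<open>t\<close>, shows that \<open>a (t * u)\<close> is to \<open>a u\<close> as \<open>a t\<close> is to
  \<open>a 1\<close>, so that \<open>a\<close> divided by \<open>a 1\<close> is multiplicative as well.\<close>

lemma chart_scaling:
  obtains k where "k \<noteq> 0" "\<And>x. x \<in> span B \<Longrightarrow> chart x = k *\<^sub>R x"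
proof -
  obtain b c where bc: "b \<in> B" "c \<in> B" "b \<noteq> c"
    using two_le_card by (metis One_nat_def card_le_Suc0_iff_eq finite_B not_less_eq_eq numeral_2_eq_2)
  define a where "a = coord_map b"
  have a: "coord_map d = a" if "d \<in> B" for d
  proof
    show "coord_map d t = a t" for t
      using coord_map_diagonal[OF that bc(1) span_zero, of t]
      by (simp add: representation_zero coord_map_zero a_def)
  qed
  have coord_a: "coord d (chart x) = a (coord d x)" if "d \<in> B" "x \<in> span B" for d x
    using coord_chart a that by simp
  have a0: "a 0 = 0" by (simp add: a_def coord_map_zero)
  \<comment> \<open>The vector \<open>u *\<^sub>R b\<close> has coordinate \<open>u\<close> at \<open>b\<close> and 0 at \<open>c\<close>.\<close>
  have add: "a (u + t) = a u + a t" for u t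
    using coord_map_diagonal[OF bc(1,2), of "u *\<^sub>R b" t] bc a a0
    by (simp add: coord_scale coord_basis span_base span_mul)
  have mult: "a (t * u) * a 1 = a t * a u" for t u
  proof -
    define x where "x = b + u *\<^sub>R c"
    have x: "x \<in> span B" unfolding x_def using bc by (intro span_add span_mul span_base)
    obtain m where m: "chart (t *\<^sub>R x) = m *\<^sub>R chart x" using chart_homothety[OF x] .
    have "coord b x = 1" "coord c x = u"
      using bc by (simp_all add: x_def coord_add coord_scale coord_basis span_base span_mul)
    moreover have "a (t * coord d x) = m * a (coord d x)" if "d \<in> B" for d
      using coord_a[OF that span_mul[OF x, of t]] coord_a[OF that x] m x chart(1)[OF x]
      by (simp add: coord_scale)
    ultimately have "a t = m * a 1" "a (t * u) = m * a u" using bc by (metis mult.right_neutral)+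
    then show ?thesis by simp
  qed
  have a1: "a 1 \<noteq> 0"
  proof
    assume "a 1 = 0"
    have bH: "b \<in> span B" using bc by (simp add: span_base)
    have "coord d (chart b) = 0" if "d \<in> B" for d
      using coord_a[OF that bH] coord_basis[OF bc(1), of d] \<open>a 1 = 0\<close> a0 by simp
    then have "chart b = 0" using coord_expansion[OF chart(1)[OF bH]] by simp
    then have "b = 0" using chart_inj[OF bH] by simp
    then show False using bc center_B by (auto simp: is_center_def)
  qed
  have lin: "a t = a 1 * t" for t
  proof -
    have "a t / a 1 = t"
    proof (rule multiplicative_additive_real[of "\<lambda>t. a t / a 1"])
      show "a (x * y) / a 1 = a x / a 1 * (a y / a 1)" for x y
        using a1 mult[of x y] by (simp add: field_simps)
    qed (use a1 in \<open>simp_all add: add add_divide_distrib\<close>)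
    with a1 show ?thesis by (simp add: field_simps)
  qed
  have "chart x = a 1 *\<^sub>R x" if x: "x \<in> span B" for x
  proof -
    have "chart x = (\<Sum>d\<in>B. (a 1 * coord d x) *\<^sub>R d)"
      using coord_expansion[OF chart(1)[OF x]] coord_a[OF _ x] lin[of "coord _ x"]
      by (metis (no_types, lifting) sum.cong)
    also have "\<dots> = a 1 *\<^sub>R (\<Sum>d\<in>B. coord d x *\<^sub>R d)" by (simp add: scaleR_sum_right)
    finally show ?thesis using coord_expansion[OF x] by simp
  qed
  with a1 that show ?thesis by blast
qed

text \<open>Knowing where \<open>F\<close> sends the point \<open>e + x\<close> determines the image of the line that joins \<open>e\<close> to
  \<open>x\<close>: it is this line itself. Its only point at infinity is \<open>x\<close>.\<close>

lemma fixed_hyperplane: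
  assumes x: "x \<in> span B" "x \<noteq> 0"
  shows "F (span {x}) = span {x}"
proof -
  obtain k where k: "k \<noteq> 0" "\<And>x. x \<in> span B \<Longrightarrow> chart x = k *\<^sub>R x"
    using chart_scaling by metis
  define w where "w = image_lift x"
  have w: "w \<noteq> 0" "F (span {x}) = span {w}" using image_lift[OF x(2)] by (simp_all add: w_def)
  have "span {w} \<in> projectivization (span B)"
    using image_hyperplane w x by (metis imageI span_in_projectivization subspace_span)
  then have wH: "w \<in> span B" using w by simp
  have nz: "e \<noteq> 0" using center_e by (simp add: is_center_def)
  have "x \<notin> span {e}"
    using x e_coefficient_zero by (auto simp: span_singleton)
  note line = image_line(2)[OF center_e this fixed_e nz w(2,1)]
  have "e + x = 1 *\<^sub>R x + 1 *\<^sub>R e" by simp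
  then have "e + x \<in> span {x, e}" using in_span_pair by blast
  then have "span {e + k *\<^sub>R x} \<in> projectivization (span {w, e})"
    using line chart(2)[OF x(1)] chart_nonzero[OF x(1)] k(2)[OF x(1)]
    by (metis imageI span_in_projectivization subspace_span)
  then obtain p q where pq: "e + k *\<^sub>R x = p *\<^sub>R w + q *\<^sub>R e"
    using chart_nonzero[OF span_mul[OF x(1)]] by (auto simp: in_span_pair)
  then have eq: "(1 - q) *\<^sub>R e = p *\<^sub>R w - k *\<^sub>R x" by (simp add: algebra_simps)
  also have "\<dots> \<in> span B" using wH x by (intro span_diff span_mul)
  finally have "1 - q = 0" by (rule e_coefficient_zero)
  with eq have "k *\<^sub>R x = p *\<^sub>R w" by simp
  then have "x = (p / k) *\<^sub>R w" using k(1) by (metis divide_inverse_commute scaleR_one scaleR_scaleR left_inverse)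
  then have "x \<in> span {w}" by (auto simp: span_singleton)
  then show ?thesis using w x span_singleton_eq by metis
qed

text \<open>The linear map that fixes \<open>e\<close> and scales the span of \<open>B\<close> by the factor of the homothety induces
  \<open>F\<close>.\<close>

theorem is_projective_linear: "projective_linear F"
proof -
  obtain k where k: "k \<noteq> 0" "\<And>x. x \<in> span B \<Longrightarrow> chart x = k *\<^sub>R x"
    using chart_scaling by metis
  define g where "g v = (if v = e then e else k *\<^sub>R v)" for v
  have ind: "independent (insert e B)" using e_notin independent_B by (rule independent_insertI)
  have eB: "e \<notin> B" using e_notin span_base by metis
  have "v \<in> span (g ` insert e B)" if "v \<in> insert e B" for v
  proof -
    have "g v \<in> span (g ` insert e B)" using that by (intro span_base imageI)
    moreover have "v = g v \<or> v = (1 / k) *\<^sub>R g v" using k(1) by (auto simp: g_def)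
    ultimately show ?thesis using span_mul by metis
  qed
  then have "span (insert e B) \<subseteq> span (g ` insert e B)"
    by (intro span_minimal) auto
  then have "span (g ` insert e B) = UNIV" using span_UNIV by auto
  from linear_bij_on_basis[OF ind this] obtain A
    where A: "linear A" "bij A" "\<And>x. x \<in> insert e B \<Longrightarrow> A x = g x" by blast
  have Ae: "A e = e" using A(3)[of e] by (simp add: g_def)
  have AB: "A x = k *\<^sub>R x" if "x \<in> span B" for x
  proof (rule linear_eq_on_span[OF A(1) _ _ that])
    show "linear ((*\<^sub>R) k)" by (rule linear_scaleR)
    show "A b = k *\<^sub>R b" if "b \<in> B" for b using A(3)[of b] eB that by (auto simp: g_def)
  qed
  have img: "A ` span {v} = span {A v}" for v using linear_span_image[OF A(1), of "{v}"] by simp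
  have "F L = A ` L" if "L \<in> RP" for L
  proof -
    obtain v where v: "v \<noteq> 0" "L = span {v}" using \<open>L \<in> RP\<close> by (rule RP_lift)
    have "v \<in> span (insert e B)" using span_UNIV by simp
    then obtain c where c: "v - c *\<^sub>R e \<in> span B" using span_breakdown_eq[of v e B] by blast
    show ?thesis
    proof (cases "c = 0")
      case True
      then have vH: "v \<in> span B" using c by simp
      then have "span {A v} = span {v}"
        using AB k(1) v by (intro span_singleton_eq) (auto simp: span_singleton)
      then show ?thesis using v img fixed_hyperplane[OF vH v(1)] by simp
    next
      case False
      define x where "x = (1 / c) *\<^sub>R (v - c *\<^sub>R e)"
      have x: "x \<in> span B" unfolding x_def using c by (rule span_mul)
      have "e + x = (1 / c) *\<^sub>R v" using False by (simp add: x_def algebra_simps)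
      then have "L = span {e + x}"
        using v span_singleton_eq[OF chart_nonzero[OF x], of v] by (auto simp: span_singleton)
      moreover have "A (e + x) = e + chart x"
        using A(1) Ae AB[OF x] k(2)[OF x] by (simp add: linear_add)
      ultimately show ?thesis using img chart(2)[OF x] by simp
    qed
  qed
  then show ?thesis using A unfolding projective_linear_def by blast
qed

end

section \<open>Reduction to a fixed frame\<close>

lemma is_center_compose_linear:
  assumes "linear A" "inj A" "is_center F v"
  shows "is_center (\<lambda>L. A ` F L) v"
proof -
  have "(\<lambda>L. A ` F L) ` l = (`) A ` F ` l" for l by (simp add: image_image)
  then show ?thesis using assms proj_line_image[OF assms(1,2)] by (auto simp: is_center_def)
qed

context projective_injection
begin

text \<open>The images of \<open>B\<close> and \<open>e\<close> form a basis, and all coefficients of the image of \<open>\<Sum>B\<close> in the images of \<open>B\<close>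
  are nonzero, because \<open>\<Sum>B\<close> is independent of any proper subset of \<open>B\<close> and \<open>F\<close> preserves this.
  Scaling the image basis by these coefficients gives a linear map \<open>A\<close> that induces \<open>F\<close> on
  the whole frame, and the inverse of \<open>A\<close> after \<open>F\<close> fixes the frame.\<close>

theorem projective_linear_if_frame:
  assumes ind_B: "independent B" and two_le: "2 \<le> card B"
    and center_B: "\<And>b. b \<in> B \<Longrightarrow> is_center F b"
    and center_sum: "is_center F (\<Sum>B)" and center_e: "is_center F e"
    and e: "e \<notin> span B" and UNIV: "span (insert e B) = UNIV"
  shows "projective_linear F"
proof -
  define s where "s = \<Sum>B"
  have fin: "finite B" using ind_B by (rule independent_imp_finite)
  have eB: "e \<notin> B" using e span_base by metis
  have ind: "independent (insert e B)" using e ind_B by (rule independent_insertI)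
  have s: "s \<noteq> 0" "s \<in> span B"
    using center_sum by (auto simp: s_def is_center_def intro: span_sum span_base)
  have img: "independent (image_lift ` insert e B)" "inj_on image_lift (insert e B)"
    using image_span_centers[OF fin center_B eB ind] by blast+
  then have inj: "inj_on image_lift B" by (simp add: inj_on_insert)

  obtain b where b: "b \<in> B" using two_le by fastforce
  then have "insert b (B - {b}) = B" by blast
  then have "F ` projectivization (span B) = projectivization (span (image_lift ` B))"
    using image_span_centers[of "B - {b}" b] fin ind_B center_B by simp
  then have "span {image_lift s} \<in> projectivization (span (image_lift ` B))"
    using s image_lift(2)[OF s(1)] by (metis imageI span_in_projectivization subspace_span)
  then have in_span: "image_lift s \<in> span (image_lift ` B)" using image_lift(1)[OF s(1)] by simp
  have notin: "image_lift s \<notin> span (image_lift ` B - {y})" if y: "y \<in> image_lift ` B" for y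
  proof -
    obtain d where d: "d \<in> B" "y = image_lift d" using y by blast
    have "s \<notin> span (B - {d})"
    proof
      assume "s \<in> span (B - {d})"
      moreover have "(\<Sum>(B - {d})) \<in> span (B - {d})" by (intro span_sum span_base)
      ultimately have "s - (\<Sum>(B - {d})) \<in> span (B - {d})" by (rule span_diff)
      moreover have "s - (\<Sum>(B - {d})) = d" using fin d by (simp add: s_def sum.remove)
      ultimately show False using ind_B d by (auto simp: dependent_def)
    qed
    moreover from this have sd: "s \<notin> B - {d}" using span_base by metis
    ultimately have "independent (insert s (B - {d}))"
      using independent_mono[OF ind_B] by (intro independent_insertI) auto
    then have *: "independent (insert (image_lift s) (image_lift ` (B - {d})))"
        "inj_on image_lift (insert s (B - {d}))"
      using image_span_centers[of "B - {d}" s] fin center_B sd by simp_all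
    have "image_lift s \<notin> image_lift ` (B - {d})"
      using *(2) sd by (auto dest: inj_onD)
    then have "image_lift s \<notin> span (image_lift ` (B - {d}))"
      using *(1) by (simp add: independent_insert)
    moreover have "image_lift ` (B - {d}) = image_lift ` B - {image_lift d}"
      using inj d(1) by (simp add: inj_on_image_set_diff)
    ultimately show ?thesis using d(2) by simp
  qed
  obtain c where c: "\<And>y. y \<in> image_lift ` B \<Longrightarrow> c y \<noteq> 0"
      "image_lift s = (\<Sum>y\<in>image_lift ` B. c y *\<^sub>R y)"
    using nonzero_coefficients[OF finite_imageI[OF fin] in_span notin] by metis

  \<comment> \<open>With these lifts of the images, the lifts of the images of \<open>B\<close> sum to the one of \<open>s\<close>.\<close>
  define r where "r v = (if v = e then 1 else c (image_lift v))" for v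
  define g where "g v = r v *\<^sub>R image_lift v" for v
  have r: "r v \<noteq> 0" if "v \<in> insert e B" for v using that c(1) by (auto simp: r_def)
  have "card (image_lift ` insert e B) = DIM('a)"
    using card_image[OF img(2)] dim_eq_card_independent[OF ind] UNIV
    by (metis dim_UNIV dim_span)
  then have lift_UNIV: "span (image_lift ` insert e B) = UNIV"
    using img(1) fin card_eq_dim[of "image_lift ` insert e B" UNIV] by auto
  have "image_lift v \<in> span (g ` insert e B)" if "v \<in> insert e B" for v
  proof -
    have "(1 / r v) *\<^sub>R g v \<in> span (g ` insert e B)" using that by (intro span_mul span_base imageI)
    then show ?thesis using r[OF that] by (simp add: g_def)
  qed
  then have "span (image_lift ` insert e B) \<subseteq> span (g ` insert e B)"
    by (intro span_minimal) auto
  then have "span (g ` insert e B) = UNIV" using lift_UNIV by auto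
  from linear_bij_on_basis[OF ind this] obtain A
    where A: "linear A" "bij A" "\<And>v. v \<in> insert e B \<Longrightarrow> A v = g v" by blast
  have "A s = (\<Sum>b\<in>B. c (image_lift b) *\<^sub>R image_lift b)"
    unfolding s_def using A(1,3) eB by (auto simp: linear_sum g_def r_def intro!: sum.cong)
  also have "\<dots> = image_lift s" using c(2) inj by (simp add: sum.reindex)
  finally have As: "A s = image_lift s" .

  obtain A' where A': "linear A'" "\<And>v. A' (A v) = v" "\<And>v. A (A' v) = v"
    using linear_injective_isomorphism[OF A(1) bij_is_inj[OF A(2)]] by auto
  then have inj_A': "inj A'" by (metis injI)
  define G where "G L = A' ` F L" for L
  have G_span: "G (span {v}) = span {A' (image_lift v)}" if "v \<noteq> 0" for v
    using linear_span_image[OF A'(1), of "{image_lift v}"] image_lift(2)[OF that] by (simp add: G_def)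
  have G_fix: "G (span {v}) = span {v}" if v: "v \<noteq> 0" "A v \<in> span {image_lift v}" for v
  proof -
    have "A v \<noteq> 0" using v(1) A'(2)[of v] linear_0[OF A'(1)] by metis
    then have "span {A v} = span {image_lift v}" using v(2) by (rule span_singleton_eq)
    then have "G (span {v}) = A' ` span {A v}" using image_lift(2)[OF v(1)] by (simp add: G_def)
    also have "\<dots> = span {A' (A v)}" using linear_span_image[OF A'(1), of "{A v}"] by simp
    finally show ?thesis using A'(2) by simp
  qed
  have nz: "v \<noteq> 0" if "v \<in> insert e B" for v
    using that center_B center_e by (auto simp: is_center_def)
  have g_mem: "A v \<in> span {image_lift v}" if "v \<in> insert e B" for v
    using A(3)[OF that] by (simp add: g_def span_base span_mul)
  have center: "is_center G v" if "is_center F v" for v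
    using is_center_compose_linear[OF A'(1) inj_A' that] by (simp add: G_def[abs_def])
  interpret G: fixed_frame G B e
  proof
    show "G L \<in> RP" if "L \<in> RP" for L
    proof -
      obtain v where v: "v \<noteq> 0" "L = span {v}" using \<open>L \<in> RP\<close> by (rule RP_lift)
      have "A' (image_lift v) \<noteq> 0" using image_lift(1)[OF v(1)] A'(3) linear_0[OF A(1)] by metis
      then show ?thesis using G_span[OF v(1)] v(2) by simp
    qed
    show "inj_on G RP"
      using inj_RP inj_A' by (auto simp: G_def inj_on_def inj_image_eq_iff)
  qed (use assms center nz g_mem G_fix As s s_def in \<open>auto simp: span_base\<close>)
  obtain C where C: "linear C" "bij C" "\<And>L. L \<in> RP \<Longrightarrow> G L = C ` L"
    using G.is_projective_linear by (auto simp: projective_linear_def)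
  have "F L = (A \<circ> C) ` L" if "L \<in> RP" for L
  proof -
    have "A ` G L = F L" using A'(3) by (simp add: G_def image_image)
    then show ?thesis using C(3)[OF that] by (simp add: image_comp)
  qed
  moreover have "linear (A \<circ> C)" "bij (A \<circ> C)"
    using A C by (simp_all add: linear_compose bij_comp)
  ultimately show ?thesis unfolding projective_linear_def by blast
qed

end

section \<open>Generic points provide a frame\<close>

theorem theorem1p8:
  fixes n :: nat
    and Hbar :: "(real ^ 'd) set set"
    and p :: "nat \<Rightarrow> (real ^ 'd) set"
    and F :: "(real ^ 'd) set \<Rightarrow> (real ^ 'd) set"
  assumes "n \<ge> 2"
    and "CARD('d) = n + 1"
    and "proj_subspace (n - 1) Hbar"
    and "generic_in (n - 1) Hbar p {1..n + 1}"
    and "p (n + 2) \<in> RP - Hbar"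
    and "\<forall>L\<in>RP. F L \<in> RP"
    and "inj_on F RP"
    and "\<forall>l. proj_line l \<and> (\<exists>i\<in>{1..n + 2}. p i \<in> l) \<longrightarrow> proj_line (F ` l)"
  shows "projective_linear F"
proof -
  interpret projective_injection F using assms(6,7) by unfold_locales auto
  obtain W where W: "subspace W" "dim W = n" "Hbar = projectivization W"
    using assms(1,3) by (auto simp: proj_subspace_def)
  have in_H: "p i \<in> Hbar" if "i \<in> {1..n + 1}" for i
    using assms(4) that by (simp add: generic_in_def)
  have "p i \<in> RP" if "i \<in> {1..n + 2}" for i
  proof (cases "i = n + 2")
    case False
    then have "p i \<in> Hbar" using that in_H by simp
    then show ?thesis using W by (auto simp: projectivization_def)
  qed (use assms(5) in simp)
  then have "\<forall>i\<in>{1..n + 2}. \<exists>v. is_lift v (p i)"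
    by (metis RP_lift is_lift_def)
  then obtain v where v: "\<And>i. i \<in> {1..n + 2} \<Longrightarrow> is_lift (v i) (p i)"
    using bchoice by metis
  then have p: "v i \<noteq> 0" "p i = span {v i}" if "i \<in> {1..n + 2}" for i
    using that by (auto simp: is_lift_def)
  have center: "is_center F (a *\<^sub>R v i)" if i: "i \<in> {1..n + 2}" and a: "a \<noteq> 0" for a i
  proof -
    have "span {a *\<^sub>R v i} = p i"
      using p[OF i] a span_singleton_eq[of "a *\<^sub>R v i" "v i"] by (simp add: span_base span_mul)
    then show ?thesis using p[OF i] a i assms(8) unfolding is_center_def by (metis scaleR_eq_0_iff)
  qed
  have v_W: "v i \<in> W" if "i \<in> {1..n + 1}" for i
    using in_H[OF that] p[of i] that W by simp
  have e_W: "v (n + 2) \<notin> W" using assms(5) p[of "n + 2"] W by simp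
  have generic: "inj_on v J" "independent (v ` J)" if J: "J \<subseteq> {1..n + 1}" "card J = n" for J
  proof -
    have "finite J" using J(1) by (rule finite_subset) simp
    moreover have "\<forall>j\<in>J. is_lift (v j) (p j)" using J v by auto
    moreover have "n \<le> n - 1 + 1" by simp
    ultimately show "inj_on v J" "independent (v ` J)"
      using assms(4) J unfolding generic_in_def by blast+
  qed

  define S where "S = v ` {1..n}"
  have S: "inj_on v {1..n}" "independent S" using generic[of "{1..n}"] by (auto simp: S_def)
  have fin: "finite S" by (simp add: S_def)
  have card_S: "card S = n" using S card_image by (fastforce simp: S_def)
  have S_W: "S \<subseteq> W" using v_W by (auto simp: S_def)
  have span_S: "span S = W"
    using S_W W S card_S by (intro subspace_dim_equal) (auto simp: span_minimal dim_eq_card_independent)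
  have "v (n + 1) \<notin> span (S - {b})" if "b \<in> S" for b
  proof -
    obtain j where j: "j \<in> {1..n}" "b = v j" using \<open>b \<in> S\<close> by (auto simp: S_def)
    \<comment> \<open>Genericity for the first \<open>n + 1\<close> points without the one that \<open>b\<close> lifts.\<close>
    define J where "J = insert (n + 1) ({1..n} - {j})"
    have J: "J \<subseteq> {1..n + 1}" "card J = n" using j assms(1) by (auto simp: J_def)
    have "S - {b} = v ` ({1..n} - {j})"
      using S(1) j by (simp add: S_def inj_on_image_set_diff)
    moreover have "v (n + 1) \<notin> v ` ({1..n} - {j})"
      using generic(1)[OF J] by (auto simp: J_def)
    ultimately show ?thesis
      using generic(2)[OF J] by (simp add: J_def independent_insert)
  qed
  then obtain c where c: "\<And>b. b \<in> S \<Longrightarrow> c b \<noteq> 0" "v (n + 1) = (\<Sum>b\<in>S. c b *\<^sub>R b)"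
    using nonzero_coefficients[OF fin, of "v (n + 1)"] v_W[of "n + 1"] span_S by auto

  \<comment> \<open>Rescaled so that \<open>v (n + 1)\<close> becomes the sum of the basis.\<close>
  define B where "B = (\<lambda>b. c b *\<^sub>R b) ` S"
  have "b \<in> span B" if "b \<in> S" for b
  proof -
    have "(1 / c b) *\<^sub>R (c b *\<^sub>R b) \<in> span B"
      unfolding B_def using that by (intro span_mul span_base imageI)
    then show ?thesis using c(1)[OF that] by simp
  qed
  then have "W \<subseteq> span B" using span_S by (metis span_minimal subsetI subspace_span)
  moreover have B_W: "B \<subseteq> W" using S_W W(1) by (auto simp: B_def subspace_scale)
  ultimately have span_B: "span B = W" using W(1) by (metis span_subspace)
  have fin_B: "finite B" using fin by (simp add: B_def)
  have "n \<le> card B" using span_card_ge_dim[OF B_W _ fin_B] span_B W by simp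
  moreover have "card B \<le> n" using card_image_le[OF fin] card_S by (metis B_def)
  ultimately have card_B: "card B = n" by simp
  then have inj: "inj_on (\<lambda>b. c b *\<^sub>R b) S" using fin card_S by (intro eq_card_imp_inj_on) (auto simp: B_def)
  have ind_B: "independent B"
    using card_eq_dim[OF B_W] card_B W fin_B span_B by simp
  have sum_B: "\<Sum>B = v (n + 1)" using c(2) inj by (simp add: B_def sum.reindex)
  have ind: "independent (insert (v (n + 2)) B)"
    using e_W span_B ind_B by (intro independent_insertI) simp_all
  have "card (insert (v (n + 2)) B) = n + 1"
    using e_W B_W fin_B card_B by (auto simp: card_insert_if)
  then have UNIV: "span (insert (v (n + 2)) B) = UNIV"
    using card_eq_dim[of "insert (v (n + 2)) B" UNIV] ind fin_B assms(2) by auto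
  show ?thesis
  proof (rule projective_linear_if_frame[OF ind_B])
    show "is_center F b" if "b \<in> B" for b
      using that c(1) center by (auto simp: B_def S_def)
    show "is_center F (\<Sum>B)" "is_center F (v (n + 2))"
      using center[of _ 1] sum_B by simp_all
  qed (use assms(1) card_B e_W span_B UNIV in simp_all)
qed

end
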